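(* Let $u$ be a packed word of length $n$. Then $$\mathbf N_u*\Theta_n=\sum_{v\ge u}(-1)^{\max(v)-\max(u)}\,t^{f(u,v)}\prod_{k=1}^{\max(u)}\big(1-t^{g(u,v,k)}\big)\,\mathbf N_v,$$ i.e. this is $\mathbf N_u((1-t)A)$ expressed in the basis $\mathbf N_v(A)$.
   Context: Packed word: word over positive integers whose set of letters is $\{1,\dots,r\}$; $\max(u)$ its maximal letter; $\mathrm{ev}(u)=(|u|_1,\dots,|u|_{\max(u)})$ its evaluation (a composition). $\mathbf{WQSym}^*_n$ is the vector space with basis $(\mathbf N_u)$ indexed by packed words of length $n$, with internal product $\mathbf N_u*\mathbf N_v=\mathbf N_{\mathrm{pack}(u,v)}$, where $\mathrm{pack}(u,v)$ replaces each biletter $(u_i,v_i)$ by its rank among the distinct biletters $\{(u_j,v_j)\}$ ordered lexicographically. For a composition $J$ of $n$ set $S^J=\sum_{\mathrm{ev}(w)=J}\mathbf N_w$. Let $\Theta_n=\sum_{k=0}^n(-t)^k\sum_{I\vDash k}(-1)^{k-\ell(I)}S^{I\cdot(n-k)}$, where $I\cdot(n-k)$ is the concatenation of $I$ with the part $n-k$ (omitted if $n-k=0$), $\ell(I)$ the number of parts, and $I$ ranges over compositions of $k$ (the empty one if $k=0$); $\Theta_n$ is the degree-$n$ part of $\sigma_1((1-t)A)=\lambda_{-t}(A)\sigma_1(A)$, and $\mathbf N_u((1-t)A):=\mathbf N_u*\Theta_n$. A packed word $v$ is finer than $u$, written $v\ge u$, if $u=\varphi(v)$ letterwise for some nondecreasing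 map $\varphi$ of the positive integers. Then each letter $k$ of $u$ has preimage a block of $q_k$ consecutive letters of $v$; write $\mathrm{ev}(u)=(i_1,\dots,i_p)$ and let $i_k^{(1)},\dots,i_k^{(q_k)}$ be the multiplicities in $v$ of the letters of the $k$-th block, in increasing order. Then $f(u,v)=\sum_{k=1}^p\sum_{j=1}^{q_k-1}i_k^{(j)}$ and $g(u,v,k)=i_k^{(q_k)}$. *)

theory Defs
  imports Complex_Main "HOL-Library.Poly_Mapping"
begin

definition packed :: "nat list \<Rightarrow> bool" where
  "packed u \<longleftrightarrow> (\<exists>r. set u = {1..r})"

text \<open>The maximal letter of the empty word is 0.\<close>

definition max_letter :: "nat list \<Rightarrow> nat" where
  "max_letter u = Max (insert 0 (set u))"

definition ev :: "nat list \<Rightarrow> nat list" where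
  "ev u = map (count_list u) [1..<Suc (max_letter u)]"

fun lex_le :: "nat \<times> nat \<Rightarrow> nat \<times> nat \<Rightarrow> bool" where
  "lex_le (a, b) (c, d) \<longleftrightarrow> a < c \<or> (a = c \<and> b \<le> d)"

definition pack_pair :: "nat list \<Rightarrow> nat list \<Rightarrow> nat list" where
  "pack_pair u v = map (\<lambda>p. card {q \<in> set (zip u v). lex_le q p}) (zip u v)"

text \<open>
  The elements of \<open>WQSym\<^sup>*\<^sub>n\<close> are the finitely supported functions \<open>nat list \<Rightarrow>\<^sub>0 'a\<close>
  whose support consists of packed words of length \<open>n\<close>.
\<close>

definition scale :: "'a::field \<Rightarrow> ('b \<Rightarrow>\<^sub>0 'a) \<Rightarrow> ('b \<Rightarrow>\<^sub>0 'a)" where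
  "scale c x = Poly_Mapping.map ((*) c) x"

definition N_basis :: "nat list \<Rightarrow> (nat list \<Rightarrow>\<^sub>0 'a::field)" where
  "N_basis u = Poly_Mapping.single u 1"

text \<open>
  Bilinear extension of the product on basis elements. Basis elements of different degrees,
  for which \<open>pack_pair\<close> is meaningless, have product 0.
\<close>

definition internal_prod ::
    "(nat list \<Rightarrow>\<^sub>0 'a::field) \<Rightarrow> (nat list \<Rightarrow>\<^sub>0 'a) \<Rightarrow> (nat list \<Rightarrow>\<^sub>0 'a)" where
  "internal_prod x y =
     (\<Sum>u\<in>Poly_Mapping.keys x. \<Sum>v\<in>Poly_Mapping.keys y.
        if length u = length v
        then scale (Poly_Mapping.lookup x u * Poly_Mapping.lookup y v) (N_basis (pack_pair u v))
        else 0)"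

definition compositions :: "nat \<Rightarrow> nat list set" where
  "compositions n = {I. 0 \<notin> set I \<and> sum_list I = n}"

definition S_comp :: "nat list \<Rightarrow> (nat list \<Rightarrow>\<^sub>0 'a::field)" where
  "S_comp J = (\<Sum>w | packed w \<and> ev w = J. N_basis w)"

definition append_part :: "nat list \<Rightarrow> nat \<Rightarrow> nat list" where
  "append_part I m = (if m = 0 then I else I @ [m])"

definition Theta :: "'a::field \<Rightarrow> nat \<Rightarrow> (nat list \<Rightarrow>\<^sub>0 'a)" where
  "Theta t n = (\<Sum>k=0..n. scale ((- t) ^ k)
     (\<Sum>I\<in>compositions k. scale ((- 1) ^ (k - length I)) (S_comp (append_part I (n - k)))))"

text \<open>\<open>finer v u\<close> stands for \<open>v \<ge> u\<close>.\<close>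

definition finer :: "nat list \<Rightarrow> nat list \<Rightarrow> bool" where
  "finer v u \<longleftrightarrow> packed v \<and> packed u \<and>
     (\<exists>\<phi>. \<phi> ` {1..} \<subseteq> {1..} \<and> mono_on {1..} \<phi> \<and> u = map \<phi> v)"

text \<open>
  If \<open>u = map \<phi> v\<close>, the letters of \<open>v\<close> that \<open>\<phi>\<close> sends to \<open>k\<close> are those standing in \<open>v\<close> at the
  positions of the letter \<open>k\<close> of \<open>u\<close>; in particular the block does not depend on \<open>\<phi>\<close>.
  The list \<open>block_mults u v k\<close> is the list of the \<open>i\<^sub>k\<^sup>(\<^sup>j\<^sup>)\<close> for \<open>j = 1, \<dots>, q\<^sub>k\<close>.
\<close>

definition block :: "nat list \<Rightarrow> nat list \<Rightarrow> nat \<Rightarrow> nat set" where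
  "block u v k = {b. (k, b) \<in> set (zip u v)}"

definition block_mults :: "nat list \<Rightarrow> nat list \<Rightarrow> nat \<Rightarrow> nat list" where
  "block_mults u v k = map (count_list v) (sorted_list_of_set (block u v k))"

definition f_stat :: "nat list \<Rightarrow> nat list \<Rightarrow> nat" where
  "f_stat u v = (\<Sum>k=1..max_letter u. sum_list (butlast (block_mults u v k)))"

definition g_stat :: "nat list \<Rightarrow> nat list \<Rightarrow> nat \<Rightarrow> nat" where
  "g_stat u v k = last (block_mults u v k)"

lemma lookup_scale: "Poly_Mapping.lookup (scale c x) w = c * Poly_Mapping.lookup x w"
  by (simp add: scale_def Poly_Mapping.map.rep_eq when_def)

lemma vector_space_scale: "vector_space scale"
  by unfold_locales
    (rule poly_mapping_eqI; simp add: lookup_scale lookup_add algebra_simps)+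

lemma internal_prod_N_basis:
  "length u = length v \<Longrightarrow>
    internal_prod (N_basis u) (N_basis v) = (N_basis (pack_pair u v) :: nat list \<Rightarrow>\<^sub>0 'a::field)"
  by (rule poly_mapping_eqI) (simp add: internal_prod_def N_basis_def lookup_scale)

lemma packed_set: "packed u \<Longrightarrow> set u = {1..max_letter u}"
proof -
  assume "packed u"
  then obtain r where r: "set u = {1..r}" by (auto simp: packed_def)
  then have "max_letter u = r" unfolding max_letter_def by (intro Max_eqI) (cases r; auto)+
  with r show ?thesis by simp
qed

lemma sum_list_ev: "packed u \<Longrightarrow> sum_list (ev u) = length u"
proof -
  assume "packed u"
  then have s: "set u = {1..<Suc (max_letter u)}" using packed_set by auto
  have "sum_list (ev u) = (\<Sum>k\<in>set u. count_list u k)"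
    unfolding ev_def s by (simp add: interv_sum_list_conv_sum_set_nat)
  then show ?thesis by (simp add: sum_count_set)
qed

lemma max_letter_le_length: "packed u \<Longrightarrow> max_letter u \<le> length u"
  using packed_set[of u] card_length[of u] by simp

lemma finite_packed: "finite {u. packed u \<and> length u = n}"
proof (rule finite_subset)
  show "{u. packed u \<and> length u = n} \<subseteq> {u. set u \<subseteq> {1..n} \<and> length u = n}"
    using packed_set max_letter_le_length by fastforce
  show "finite {u. set u \<subseteq> {1..n} \<and> length u = n}"
    by (rule finite_lists_length_eq) simp
qed

lemma finite_ev: "finite {w. packed w \<and> ev w = J}"
  by (rule finite_subset[OF _ finite_packed[of "sum_list J"]]) (auto simp: sum_list_ev)

lemma finite_finer: "finite {v. finer v u}"
  by (rule finite_subset[OF _ finite_packed[of "length u"]]) (auto simp: finer_def)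

lemma length_le_sum_list: "0 \<notin> set I \<Longrightarrow> length I \<le> sum_list (I :: nat list)"
  by (induction I) auto

lemma finite_compositions: "finite (compositions n)"
proof (rule finite_subset)
  show "compositions n \<subseteq> {I. set I \<subseteq> {0..n} \<and> length I \<le> n}"
    using length_le_sum_list member_le_sum_list by (fastforce simp: compositions_def)
  show "finite {I. set I \<subseteq> {0..n} \<and> length I \<le> n}"
    by (rule finite_lists_length_le) simp
qed

end

theory Submission imports Defs begin

text \<open>
  The coefficient of \<open>N\<^sub>w\<close> in \<open>\<Theta>\<^sub>n\<close>, for \<open>n > 0\<close>, is \<open>(-1)\<^sup>r (t\<^sup>n - t\<^bsup>n - l\<^esup>)\<close>, where \<open>r\<close> is the
  maximal letter of \<open>w\<close> and \<open>l\<close> its multiplicity. For \<open>u = \<phi>(v)\<close>, the packed words \<open>w\<close> with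
  \<open>pack(u, w) = v\<close> are the \<open>\<psi>(v)\<close>, where \<open>\<psi>\<close> maps the letters of \<open>v\<close> onto an initial interval
  \<open>{1..r}\<close> and increases strictly on each fibre of \<open>\<phi>\<close>. The fibre \<open>T\<close> of \<open>\<psi>\<close> over \<open>r\<close> is an
  arbitrary nonempty set of block ends, and the signed count of the labelings of the remaining
  letters is \<open>(-1)\<close> to their number. The coefficient of \<open>N\<^sub>v\<close> is thus an alternating sum over all
  sets \<open>T\<close> of block ends, which factors into the stated product.
\<close>

section \<open>Strict labelings and their top fibres\<close>

text \<open>The value 0 off \<open>X\<close> makes a labeling determined by its restriction to
  \<open>X\<close>: there are then finitely many of them for finite \<open>X\<close>, and distinct
  ones give distinct words.\<close>

definition strict_labelings :: "('a \<Rightarrow> 'a \<Rightarrow> bool) \<Rightarrow> 'a set \<Rightarrow> ('a \<Rightarrow> nat) set" where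
  "strict_labelings R X = {\<psi>. (\<forall>x. x \<notin> X \<longrightarrow> \<psi> x = 0) \<and> (\<exists>r. \<psi> ` X = {1..r}) \<and>
     (\<forall>x\<in>X. \<forall>y\<in>X. R x y \<longrightarrow> \<psi> x < \<psi> y)}"

definition maximal_elems :: "('a \<Rightarrow> 'a \<Rightarrow> bool) \<Rightarrow> 'a set \<Rightarrow> 'a set" where
  "maximal_elems R X = {x \<in> X. \<forall>y\<in>X. \<not> R x y}"

lemma strict_labelings_image:
  "\<psi> \<in> strict_labelings R X \<Longrightarrow> \<psi> ` X = {1..card (\<psi> ` X)}"
  unfolding strict_labelings_def by force

lemma strict_labelings_empty: "strict_labelings R {} = {\<lambda>_. 0}"
  by (auto simp: strict_labelings_def intro: exI[of _ 0])

lemma finite_strict_labelings: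
  assumes "finite X"
  shows "finite (strict_labelings R X)"
proof (rule finite_subset)
  show "strict_labelings R X \<subseteq>
      {\<psi>. \<forall>x. (x \<in> X \<longrightarrow> \<psi> x \<in> {..card X}) \<and> (x \<notin> X \<longrightarrow> \<psi> x = 0)}"
  proof
    fix \<psi> assume *: "\<psi> \<in> strict_labelings R X"
    have "\<psi> x \<le> card X" if "x \<in> X" for x
    proof -
      have "\<psi> x \<in> {1..card (\<psi> ` X)}"
        using strict_labelings_image[OF *] that by blast
      then show ?thesis using card_image_le[OF assms, of \<psi>] by simp
    qed
    with * show "\<psi> \<in> {\<psi>. \<forall>x. (x \<in> X \<longrightarrow> \<psi> x \<in> {..card X}) \<and> (x \<notin> X \<longrightarrow> \<psi> x = 0)}"
      by (auto simp: strict_labelings_def)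
  qed
qed (rule finite_set_of_finite_funs[OF assms finite_atMost])

text \<open>Elements of \<open>T\<close> are maximal, so they never have to lie strictly below
  anything, and a new top label can be given to all of them at once.\<close>

lemma extend_strict_labeling:
  assumes T: "T \<subseteq> maximal_elems R X" "T \<noteq> {}" and \<psi>: "\<psi> \<in> strict_labelings R (X - T)"
  defines "r \<equiv> card (\<psi> ` (X - T))"
  defines "\<psi>' \<equiv> \<lambda>x. if x \<in> T then Suc r else \<psi> x"
  shows "\<psi>' \<in> strict_labelings R X" "card (\<psi>' ` X) = Suc r" "{x \<in> X. \<psi>' x = Suc r} = T"
proof -
  have im: "\<psi> ` (X - T) = {1..r}" unfolding r_def by (rule strict_labelings_image[OF \<psi>])
  have TX: "T \<subseteq> X" using T(1) by (auto simp: maximal_elems_def)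
  have "\<psi>' ` X = \<psi>' ` T \<union> \<psi>' ` (X - T)" using TX by blast
  also have "\<psi>' ` T = {Suc r}" using T(2) by (auto simp: \<psi>'_def)
  also have "\<psi>' ` (X - T) = \<psi> ` (X - T)" by (intro image_cong) (auto simp: \<psi>'_def)
  finally have im': "\<psi>' ` X = {1..Suc r}" by (auto simp: im)
  then show "card (\<psi>' ` X) = Suc r" by simp
  have le: "\<psi> x \<le> r" if "x \<in> X - T" for x using im that by auto
  have "x \<in> T" if "x \<in> X" "\<psi>' x = Suc r" for x
    using le[of x] that by (auto simp: \<psi>'_def split: if_splits)
  moreover have "\<psi>' x = Suc r" if "x \<in> T" for x using that by (simp add: \<psi>'_def)
  ultimately show "{x \<in> X. \<psi>' x = Suc r} = T" using TX by blast
  have "\<psi>' x < \<psi>' y" if "x \<in> X" "y \<in> X" "R x y" for x y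
  proof -
    have "x \<notin> T" using that T(1) by (auto simp: maximal_elems_def)
    then show ?thesis
      using that le[of x] \<psi> by (auto simp: \<psi>'_def strict_labelings_def)
  qed
  moreover have "\<psi>' x = 0" if "x \<notin> X" for x
    using that TX \<psi> by (auto simp: \<psi>'_def strict_labelings_def)
  ultimately show "\<psi>' \<in> strict_labelings R X"
    using im' unfolding strict_labelings_def by blast
qed

text \<open>Inverse of the extension: an element carrying the top label cannot be
  \<open>R\<close>-below another one, which would need a larger label. Resetting \<open>T\<close> to
  0 restores the default value off \<open>X - T\<close>.\<close>

lemma restrict_strict_labeling:
  assumes X: "X \<noteq> {}" "finite X" and \<psi>: "\<psi> \<in> strict_labelings R X"
  defines "r \<equiv> card (\<psi> ` X)"
  defines "T \<equiv> {x \<in> X. \<psi> x = r}"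
  defines "\<psi>' \<equiv> \<lambda>x. if x \<in> T then 0 else \<psi> x"
  shows "T \<subseteq> maximal_elems R X" "T \<noteq> {}" "\<psi>' \<in> strict_labelings R (X - T)"
    "Suc (card (\<psi>' ` (X - T))) = r"
proof -
  have im: "\<psi> ` X = {1..r}" unfolding r_def by (rule strict_labelings_image[OF \<psi>])
  have r: "r > 0" unfolding r_def using X by (simp add: card_gt_0_iff)
  then have "r \<in> \<psi> ` X" by (simp add: im)
  then show "T \<noteq> {}" by (auto simp: T_def)
  have le: "\<psi> x \<le> r" if "x \<in> X" for x using im that by auto
  have "\<not> R x y" if "x \<in> T" "y \<in> X" for x y
  proof
    assume "R x y"
    then have "\<psi> x < \<psi> y" using that \<psi> by (auto simp: T_def strict_labelings_def)
    then show False using that le[of y] by (simp add: T_def)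
  qed
  then show "T \<subseteq> maximal_elems R X" by (auto simp: T_def maximal_elems_def)
  have "\<psi>' ` (X - T) = \<psi> ` (X - T)" by (intro image_cong) (auto simp: \<psi>'_def)
  also have "\<dots> = \<psi> ` X - {r}" by (auto simp: T_def)
  also have "\<dots> = {1..r - 1}" using r by (auto simp: im)
  finally have im': "\<psi>' ` (X - T) = {1..r - 1}" .
  then show "Suc (card (\<psi>' ` (X - T))) = r" using r by simp
  show "\<psi>' \<in> strict_labelings R (X - T)"
    using \<psi> im' unfolding strict_labelings_def by (auto simp: \<psi>'_def)
qed

text \<open>A labeling is the same as its top fibre together with a labeling of the rest. The
  summand \<open>F\<close> sees only the number of labels and the top fibre, which covers both the
  plain signed count and the weighted one below.\<close>

lemma sum_strict_labelings_by_top_fibre: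
  assumes "finite X" "X \<noteq> {}"
  shows "(\<Sum>\<psi>\<in>strict_labelings R X. F (card (\<psi> ` X)) {x \<in> X. \<psi> x = card (\<psi> ` X)}) =
    (\<Sum>T\<in>Pow (maximal_elems R X) - {{}}. \<Sum>\<psi>\<in>strict_labelings R (X - T).
       F (Suc (card (\<psi> ` (X - T)))) T)"
    (is "?L = ?R")
proof -
  have fin: "finite (maximal_elems R X)" using assms(1) by (simp add: maximal_elems_def)
  let ?S = "SIGMA T:Pow (maximal_elems R X) - {{}}. strict_labelings R (X - T)"
  have "?R = (\<Sum>(T, \<psi>)\<in>?S. F (Suc (card (\<psi> ` (X - T)))) T)"
    by (rule sum.Sigma) (use fin assms(1) finite_strict_labelings in auto)
  also have "\<dots> = ?L"
  \<comment> \<open>Here \<open>j\<close> splits off the top fibre and \<open>i\<close> puts it back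
    with a new top label.\<close>
  proof (rule sym, rule sum.reindex_bij_witness[where
        i = "\<lambda>(T, \<psi>) x. if x \<in> T then Suc (card (\<psi> ` (X - T))) else \<psi> x" and
        j = "\<lambda>\<psi>. ({x \<in> X. \<psi> x = card (\<psi> ` X)},
               \<lambda>x. if x \<in> {x \<in> X. \<psi> x = card (\<psi> ` X)} then 0 else \<psi> x)"])
    fix \<psi> assume \<psi>: "\<psi> \<in> strict_labelings R X"
    note res = restrict_strict_labeling[OF assms(2,1) \<psi>]
    let ?T = "{x \<in> X. \<psi> x = card (\<psi> ` X)}"
    let ?\<psi> = "\<lambda>x. if x \<in> ?T then 0 else \<psi> x"
    show "(case (?T, ?\<psi>) of (T, \<psi>) \<Rightarrow> \<lambda>x. if x \<in> T then Suc (card (\<psi> ` (X - T))) else \<psi> x) = \<psi>"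
      unfolding prod.case res(4) by auto
    show "(?T, ?\<psi>) \<in> ?S" using res(1-3) by blast
    show "(case (?T, ?\<psi>) of (T, \<psi>) \<Rightarrow> F (Suc (card (\<psi> ` (X - T)))) T) = F (card (\<psi> ` X)) ?T"
      unfolding prod.case res(4) ..
  next
    fix p assume "p \<in> ?S"
    then obtain T \<psi> where p: "p = (T, \<psi>)" and T: "T \<subseteq> maximal_elems R X" "T \<noteq> {}"
      and \<psi>: "\<psi> \<in> strict_labelings R (X - T)" by auto
    note ext = extend_strict_labeling[OF T \<psi>]
    let ?\<psi> = "case p of (T, \<psi>) \<Rightarrow> \<lambda>x. if x \<in> T then Suc (card (\<psi> ` (X - T))) else \<psi> x"
    show "?\<psi> \<in> strict_labelings R X" using ext(1) by (simp add: p)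
    have "\<psi> x = 0" if "x \<in> T" for x using \<psi> that by (auto simp: strict_labelings_def)
    then show "({x \<in> X. ?\<psi> x = card (?\<psi> ` X)},
        \<lambda>x. if x \<in> {x \<in> X. ?\<psi> x = card (?\<psi> ` X)} then 0 else ?\<psi> x) = p"
      unfolding p prod.case ext(2,3) by auto
  qed
  finally show ?thesis by (rule sym)
qed

section \<open>Signed counts of strict labelings\<close>

text \<open>This is the expansion of the product of \<open>- 1 + 1\<close> over
  \<open>A\<close>.\<close>

lemma sum_Pow_minus_one:
  assumes "finite A" "A \<noteq> {}"
  shows "(\<Sum>T\<in>Pow A. (- 1) ^ card T) = (0 :: 'a::comm_ring_1)"
  using prod_add[OF assms(1), of "\<lambda>_. - 1 :: 'a" "\<lambda>_. 1"] assms
  by (simp add: power_0_left)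

lemma neg_one_power_diff:
  "k \<le> m \<Longrightarrow> (- 1 :: 'a::ring_1) ^ (m - k) = (- 1) ^ m * (- 1) ^ k"
  by (cases "even m"; cases "even k") (auto simp: minus_one_power_iff)

text \<open>The reciprocity between strict and weak order polynomials, evaluated at \<open>-1\<close>.\<close>

lemma sum_strict_labelings_sign:
  fixes R :: "'b::linorder \<Rightarrow> 'b \<Rightarrow> bool"
  assumes "finite X" and R: "\<And>x y. R x y \<Longrightarrow> x < y"
  shows "(\<Sum>\<psi>\<in>strict_labelings R X. (- 1) ^ card (\<psi> ` X)) = ((- 1) ^ card X :: 'a::comm_ring_1)"
  using assms(1)
proof (induction X rule: finite_psubset_induct)
  case (psubset X)
  show ?case
  proof (cases "X = {}")
    case True
    then show ?thesis by (simp add: strict_labelings_empty)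
  next
    case False
    let ?M = "maximal_elems R X"
    have fin: "finite ?M" using psubset.hyps by (simp add: maximal_elems_def)
    \<comment> \<open>Since \<open>R\<close> refines the linear order, the largest element of
      \<open>X\<close> is maximal; hence the alternating sum over all subsets of \<open>?M\<close>
      vanishes.\<close>
    have "Max X \<in> ?M"
      using R Max_ge[OF psubset.hyps] Max_in[OF psubset.hyps False]
      by (force simp: maximal_elems_def)
    then have ne: "?M \<noteq> {}" by blast
    have "(\<Sum>\<psi>\<in>strict_labelings R X. (- 1) ^ card (\<psi> ` X)) =
        (\<Sum>T\<in>Pow ?M - {{}}. \<Sum>\<psi>\<in>strict_labelings R (X - T). (- 1) ^ Suc (card (\<psi> ` (X - T))) :: 'a)"
      by (rule sum_strict_labelings_by_top_fibre[OF psubset.hyps False, where F = "\<lambda>r _. (- 1) ^ r"])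
    also have "\<dots> = (\<Sum>T\<in>Pow ?M - {{}}. - ((- 1) ^ card X * (- 1) ^ card T))"
    proof (rule sum.cong[OF refl])
      fix T assume T: "T \<in> Pow ?M - {{}}"
      then have TX: "T \<subseteq> X" by (auto simp: maximal_elems_def)
      with T have "X - T \<subset> X" by blast
      from psubset.IH[OF this]
      show "(\<Sum>\<psi>\<in>strict_labelings R (X - T). (- 1) ^ Suc (card (\<psi> ` (X - T))) :: 'a) =
          - ((- 1) ^ card X * (- 1) ^ card T)"
        using TX psubset.hyps
        by (simp add: sum_negf card_Diff_subset finite_subset card_mono neg_one_power_diff)
    qed
    also have "\<dots> = - ((- 1) ^ card X) * (\<Sum>T\<in>Pow ?M - {{}}. (- 1) ^ card T)"
      by (simp add: sum_negf sum_distrib_left)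
    \<comment> \<open>Only the term 1 of the empty set is removed from a vanishing sum.\<close>
    also have "(\<Sum>T\<in>Pow ?M - {{}}. (- 1) ^ card T) = (- 1 :: 'a)"
      using sum_Pow_minus_one[OF fin ne, where 'a = 'a] fin by (simp add: sum_diff1)
    finally show ?thesis by simp
  qed
qed

text \<open>The weight \<open>h {} - h T\<close> has the shape of the coefficients of
  \<open>Theta\<close>. Once the top fibre is fixed, the rest contributes only a sign; the part with
  \<open>h {}\<close> is a plain signed count and supplies the missing term for the empty
  \<open>T\<close>.\<close>

lemma sum_strict_labelings_top_fibre:
  fixes R :: "'b::linorder \<Rightarrow> 'b \<Rightarrow> bool" and h :: "'b set \<Rightarrow> 'a::comm_ring_1"
  assumes X: "finite X" "X \<noteq> {}" and R: "\<And>x y. R x y \<Longrightarrow> x < y"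
  shows "(\<Sum>\<psi>\<in>strict_labelings R X.
      (- 1) ^ card (\<psi> ` X) * (h {} - h {x \<in> X. \<psi> x = card (\<psi> ` X)})) =
    (- 1) ^ card X * (\<Sum>T\<in>Pow (maximal_elems R X). (- 1) ^ card T * h T)"
proof -
  let ?M = "maximal_elems R X"
  have fin: "finite ?M" using X by (simp add: maximal_elems_def)
  have "(\<Sum>\<psi>\<in>strict_labelings R X. (- 1) ^ card (\<psi> ` X) * h {x \<in> X. \<psi> x = card (\<psi> ` X)}) =
      (\<Sum>T\<in>Pow ?M - {{}}. \<Sum>\<psi>\<in>strict_labelings R (X - T). (- 1) ^ Suc (card (\<psi> ` (X - T))) * h T)"
    by (rule sum_strict_labelings_by_top_fibre[OF X, where F = "\<lambda>r T. (- 1) ^ r * h T"])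
  also have "\<dots> = (\<Sum>T\<in>Pow ?M - {{}}. - ((- 1) ^ card X * ((- 1) ^ card T * h T)))"
  proof (rule sum.cong[OF refl])
    fix T assume "T \<in> Pow ?M - {{}}"
    then have TX: "T \<subseteq> X" by (auto simp: maximal_elems_def)
    have "(\<Sum>\<psi>\<in>strict_labelings R (X - T). (- 1) ^ card (\<psi> ` (X - T))) = ((- 1) ^ card (X - T) :: 'a)"
      by (rule sum_strict_labelings_sign) (use X R in auto)
    then show "(\<Sum>\<psi>\<in>strict_labelings R (X - T). (- 1) ^ Suc (card (\<psi> ` (X - T))) * h T) =
        - ((- 1) ^ card X * ((- 1) ^ card T * h T))"
      using TX X
      by (simp add: sum_negf card_Diff_subset finite_subset card_mono neg_one_power_diff
          flip: sum_distrib_right mult.assoc)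
  qed
  also have "\<dots> = - ((- 1) ^ card X * (\<Sum>T\<in>Pow ?M - {{}}. (- 1) ^ card T * h T))"
    by (simp add: sum_negf sum_distrib_left)
  also have "(\<Sum>T\<in>Pow ?M - {{}}. (- 1) ^ card T * h T) = (\<Sum>T\<in>Pow ?M. (- 1) ^ card T * h T) - h {}"
    using fin by (simp add: sum_diff1)
  finally show ?thesis
    using sum_strict_labelings_sign[OF X(1) R, where 'a = 'a]
    by (simp add: right_diff_distrib sum_subtractf flip: sum_distrib_right)
qed

section \<open>Coefficients of \<open>Theta\<close> and of an internal product\<close>

lemma length_ev: "length (ev w) = max_letter w"
  by (simp add: ev_def)

lemma zero_notin_ev: "packed w \<Longrightarrow> 0 \<notin> set (ev w)"
  using packed_set[of w] by (auto simp: ev_def count_list_0_iff)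

lemma lookup_S_comp:
  "Poly_Mapping.lookup (S_comp J :: nat list \<Rightarrow>\<^sub>0 'a::field) w = of_bool (packed w \<and> ev w = J)"
  using finite_ev[of J]
  by (simp add: S_comp_def lookup_sum N_basis_def lookup_single when_def)

lemma sum_list_append_part: "sum_list (append_part I m) = sum_list I + m"
  by (simp add: append_part_def)

text \<open>The signs of \<open>(- t) ^ m\<close> and of a composition of \<open>m\<close> with
  \<open>k\<close> parts combine to the parity of \<open>k\<close>.\<close>

lemma minus_power_mult_sign:
  "k \<le> m \<Longrightarrow> (- t) ^ m * (- 1) ^ (m - k) = (- 1) ^ k * (t :: 'a::field) ^ m"
  by (simp add: neg_one_power_diff power_minus[of t m])

text \<open>For \<open>n > 0\<close> a composition of \<open>n\<close> arises as
  \<open>append_part I (n - k)\<close> in exactly two ways: with \<open>k = n\<close> and nothing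
  appended, or by splitting off its last part. The lengths of \<open>I\<close> differ by one, so the
  signs are opposite. For \<open>n = 0\<close> only the first way exists.\<close>

lemma lookup_Theta:
  fixes t :: "'a::field"
  shows "Poly_Mapping.lookup (Theta t n) w =
    (if packed w \<and> length w = n
     then (- 1) ^ max_letter w * (if n = 0 then 1 else t ^ n - t ^ (n - last (ev w))) else 0)"
proof -
  define c where "c k = (\<Sum>I\<in>compositions k.
    (- 1) ^ (k - length I) * of_bool (packed w \<and> ev w = append_part I (n - k)) :: 'a)" for k
  have expand: "Poly_Mapping.lookup (Theta t n) w = (\<Sum>k=0..n. (- t) ^ k * c k)"
    by (simp add: Theta_def c_def lookup_sum lookup_scale lookup_S_comp)
  show ?thesis
  proof (cases "packed w \<and> length w = n")
    case False
    have "c k = 0" if "k \<le> n" for k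
    proof -
      have "\<not> (packed w \<and> ev w = append_part I (n - k))" if "I \<in> compositions k" for I
        using False \<open>k \<le> n\<close> that sum_list_ev[of w]
        by (auto simp: compositions_def sum_list_append_part)
      then show ?thesis unfolding c_def by (intro sum.neutral) simp
    qed
    then show ?thesis using False by (auto simp: expand)
  next
    case True
    then have w: "packed w" and n: "sum_list (ev w) = n" using sum_list_ev by auto
    have mem: "ev w \<in> compositions n" using zero_notin_ev[OF w] n by (simp add: compositions_def)
    have "c n = (\<Sum>I\<in>compositions n. if I = ev w then (- 1) ^ (n - length I) else 0)"
      unfolding c_def by (intro sum.cong) (auto simp: append_part_def w)
    then have cn: "c n = (- 1) ^ (n - max_letter w)"
      using mem by (simp add: finite_compositions length_ev)
    have len: "max_letter w \<le> n" using max_letter_le_length True by blast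
    have top: "(- t) ^ n * c n = (- 1) ^ max_letter w * t ^ n"
      unfolding cn by (rule minus_power_mult_sign[OF len])
    show ?thesis
    proof (cases "n = 0")
      case True
      then show ?thesis using w expand top by (simp add: \<open>packed w \<and> length w = n\<close>)
    next
      case False
      \<comment> \<open>The only \<open>k < n\<close> that contributes: the appended part
        \<open>n - k\<close> must be the last part of \<open>ev w\<close>.\<close>
      define k0 where "k0 = n - last (ev w)"
      have ne: "ev w \<noteq> []" using n False by auto
      then have ev: "ev w = butlast (ev w) @ [last (ev w)]" by simp
      then have "n = sum_list (butlast (ev w)) + last (ev w)"
        using n by (metis add.right_neutral sum_list.Cons sum_list.Nil sum_list_append)
      then have k0: "k0 = sum_list (butlast (ev w))" and last: "last (ev w) = n - k0"
        by (simp_all add: k0_def)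
      have "last (ev w) > 0" using zero_notin_ev[OF w] last_in_set[OF ne] by (metis gr0I)
      then have k0n: "k0 < n" using False by (simp add: k0_def)
      have zero: "0 \<notin> set (butlast (ev w))"
        using zero_notin_ev[OF w] in_set_butlastD by metis
      have memb: "butlast (ev w) \<in> compositions k0"
        using zero by (simp add: compositions_def k0)
      have eq: "ev w = append_part I (n - k) \<longleftrightarrow> I = butlast (ev w) \<and> k = k0" if "k < n" for I k
        using that last k0n ev by (subst ev) (auto simp: append_part_def)
      \<comment> \<open>The exponent contains \<open>max_letter w - 1\<close> because
        \<open>I\<close> is \<open>ev w\<close> without its last part.\<close>
      have ck: "c k = (if k = k0 then (- 1) ^ (k0 - (max_letter w - 1)) else 0)" if "k < n" for k
      proof -
        have "c k = (\<Sum>I\<in>compositions k. if I = butlast (ev w) then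
            (if k = k0 then (- 1) ^ (k - length I) else 0) else 0)"
          unfolding c_def eq[OF that] by (intro sum.cong) (auto simp: w)
        then show ?thesis using memb by (simp add: finite_compositions length_ev)
      qed
      have r: "max_letter w > 0" using ne length_ev[of w] by (cases "max_letter w") auto
      have len': "max_letter w - 1 \<le> k0"
        using length_le_sum_list[OF zero] by (simp add: k0 length_ev)
      have "(\<Sum>k=0..n. (- t) ^ k * c k) = (- t) ^ n * c n + (\<Sum>k\<in>{0..<n}. (- t) ^ k * c k)"
        by (simp add: atLeastLessThanSuc_atLeastAtMost[symmetric])
      also have "(\<Sum>k\<in>{0..<n}. (- t) ^ k * c k) =
          (\<Sum>k\<in>{0..<n}. if k = k0 then (- t) ^ k * (- 1) ^ (k0 - (max_letter w - 1)) else 0)"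
        by (intro sum.cong) (auto simp: ck)
      also have "\<dots> = (- t) ^ k0 * (- 1) ^ (k0 - (max_letter w - 1))" using k0n by simp
      also have "\<dots> = (- 1) ^ (max_letter w - 1) * t ^ k0"
        by (rule minus_power_mult_sign[OF len'])
      \<comment> \<open>The part split off produces the minus sign of the second power of
        \<open>t\<close>.\<close>
      also have "(- 1) ^ (max_letter w - 1) = - ((- 1) ^ max_letter w :: 'a)"
        using r by (cases "max_letter w") auto
      finally show ?thesis
        using True False top by (simp add: expand k0_def algebra_simps)
    qed
  qed
qed

text \<open>The set \<open>A\<close> may be larger than the support of \<open>y\<close>, so the sum
  can run over all packed words of one length whatever \<open>t\<close> is.\<close>

lemma lookup_internal_prod_N_basis:
  fixes y :: "nat list \<Rightarrow>\<^sub>0 'a::field"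
  assumes "finite A" "\<And>w. w \<notin> A \<Longrightarrow> Poly_Mapping.lookup y w = 0"
    "\<And>w. w \<in> A \<Longrightarrow> length w = length u"
  shows "Poly_Mapping.lookup (internal_prod (N_basis u) y) v =
    (\<Sum>w | w \<in> A \<and> pack_pair u w = v. Poly_Mapping.lookup y w)"
proof -
  have sub: "Poly_Mapping.keys y \<subseteq> A" using assms(2) by (metis in_keys_iff subsetI)
  have keys: "Poly_Mapping.keys (N_basis u :: nat list \<Rightarrow>\<^sub>0 'a) = {u}"
    by (simp add: N_basis_def)
  have prod: "internal_prod (N_basis u) y = (\<Sum>w\<in>Poly_Mapping.keys y.
      if length u = length w then scale (Poly_Mapping.lookup y w) (N_basis (pack_pair u w)) else 0)"
    unfolding internal_prod_def keys by (simp add: N_basis_def[of u] cong: if_cong)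
  have "Poly_Mapping.lookup (internal_prod (N_basis u) y) v =
      (\<Sum>w\<in>Poly_Mapping.keys y. if pack_pair u w = v then Poly_Mapping.lookup y w else 0)"
    unfolding prod lookup_sum using sub assms(3)
    by (intro sum.cong) (auto simp: N_basis_def lookup_scale lookup_single when_def)
  also have "\<dots> = (\<Sum>w\<in>A. if pack_pair u w = v then Poly_Mapping.lookup y w else 0)"
    using assms(1) sub by (intro sum.mono_neutral_left) (auto simp: in_keys_iff)
  finally show ?thesis
    using assms(1) by (simp add: sum.inter_filter)
qed

section \<open>Lexicographic ranks and packing of pairs\<close>

lemma lex_le_refl: "lex_le p p"
  by (cases p) simp

lemma lex_le_trans: "lex_le p q \<Longrightarrow> lex_le q r \<Longrightarrow> lex_le p r"
  by (cases p; cases q; cases r) auto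

lemma lex_le_antisym: "lex_le p q \<Longrightarrow> lex_le q p \<Longrightarrow> p = q"
  by (cases p; cases q) auto

lemma lex_le_linear: "lex_le p q \<or> lex_le q p"
  by (cases p; cases q) auto

text \<open>The rank counts a down-set of a total order; down-sets are nested, strictly so for
  distinct elements.\<close>

lemma lex_rank_le_iff:
  assumes "finite S" "p \<in> S" "q \<in> S"
  shows "card {x \<in> S. lex_le x p} \<le> card {x \<in> S. lex_le x q} \<longleftrightarrow> lex_le p q"
proof
  assume "lex_le p q"
  then show "card {x \<in> S. lex_le x p} \<le> card {x \<in> S. lex_le x q}"
    using assms(1) by (intro card_mono) (auto intro: lex_le_trans simp del: lex_le.simps)
next
  assume le: "card {x \<in> S. lex_le x p} \<le> card {x \<in> S. lex_le x q}"
  show "lex_le p q"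
  proof (rule ccontr)
    assume n: "\<not> lex_le p q"
    then have "lex_le q p" using lex_le_linear by blast
    then have "{x \<in> S. lex_le x q} \<subset> {x \<in> S. lex_le x p}"
      using n assms lex_le_trans lex_le_refl by blast
    then have "card {x \<in> S. lex_le x q} < card {x \<in> S. lex_le x p}"
      using assms(1) by (intro psubset_card_mono) auto
    with le show False by simp
  qed
qed

lemma length_pack_pair: "length u = length w \<Longrightarrow> length (pack_pair u w) = length u"
  by (simp add: pack_pair_def)

lemma pack_pair_nth_le_iff:
  assumes "length u = length w" "i < length u" "j < length u"
  shows "pack_pair u w ! i \<le> pack_pair u w ! j \<longleftrightarrow> lex_le (u ! i, w ! i) (u ! j, w ! j)"
proof -
  have "(u ! i, w ! i) \<in> set (zip u w)" "(u ! j, w ! j) \<in> set (zip u w)"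
    using assms by (auto simp: in_set_zip)
  then show ?thesis
    using assms by (simp add: pack_pair_def lex_rank_le_iff del: lex_le.simps)
qed

text \<open>The rank is an injection of the biletters into \<open>{1..card S}\<close>, hence onto by
  counting.\<close>

lemma packed_pack_pair: "packed (pack_pair u w)"
proof -
  define S where "S = set (zip u w)"
  define rank where "rank p = card {q \<in> S. lex_le q p}" for p
  have fin: "finite S" by (simp add: S_def)
  have "inj_on rank S"
    by (intro inj_onI lex_le_antisym)
      (auto simp: rank_def simp flip: lex_rank_le_iff[OF fin])
  then have "card (rank ` S) = card {1..card S}" by (simp add: card_image)
  moreover have "rank ` S \<subseteq> {1..card S}"
  proof
    fix k assume "k \<in> rank ` S"
    then obtain p where p: "p \<in> S" "k = rank p" by blast
    have "{q \<in> S. lex_le q p} \<noteq> {}" using p lex_le_refl by blast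
    then have "k > 0" using p fin by (simp add: rank_def card_gt_0_iff)
    moreover have "k \<le> card S" unfolding p rank_def using fin by (intro card_mono) auto
    ultimately show "k \<in> {1..card S}" by simp
  qed
  ultimately have "rank ` S = {1..card S}" by (intro card_subset_eq) auto
  then have "set (pack_pair u w) = {1..card S}"
    by (simp add: pack_pair_def rank_def S_def)
  then show ?thesis by (auto simp: packed_def)
qed

text \<open>Replaces the search for a monotone map on all positive integers by a comparison of
  positions.\<close>

lemma finerI:
  assumes "packed v" "packed u" "length u = length v"
    and mono: "\<And>i j. i < length v \<Longrightarrow> j < length v \<Longrightarrow> v ! i \<le> v ! j \<Longrightarrow> u ! i \<le> u ! j"
  shows "finer v u"
proof -
  \<comment> \<open>The largest letter of \<open>u\<close> at a position where \<open>v\<close> has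
    a letter at most \<open>b\<close>. The added 1 keeps the set nonempty and the value positive for
    every \<open>b\<close>.\<close>
  define \<phi> where "\<phi> b = Max (insert 1 {u ! i |i. i < length v \<and> v ! i \<le> b})" for b
  have fin: "finite {u ! i |i. i < length v \<and> v ! i \<le> b}" for b by simp
  have "mono_on {1..} \<phi>"
    unfolding \<phi>_def by (intro mono_onI Max_mono) (use fin in auto)
  moreover have "\<phi> b \<ge> 1" for b unfolding \<phi>_def using fin by (intro Max_ge) auto
  moreover have "\<phi> (v ! i) = u ! i" if "i < length v" for i
  proof -
    have "u ! i \<ge> 1" using packed_set[OF assms(2)] that assms(3) nth_mem[of i u] by auto
    then show ?thesis unfolding \<phi>_def using that mono fin by (intro Max_eqI) auto
  qed
  then have "u = map \<phi> v" using assms(3) by (intro nth_equalityI) auto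
  ultimately show ?thesis using assms(1,2) by (auto simp: finer_def)
qed

text \<open>The lexicographic order compares the letters of \<open>u\<close> first.\<close>

lemma finer_pack_pair:
  assumes "packed u" "length u = length w"
  shows "finer (pack_pair u w) u"
proof (rule finerI)
  fix i j assume "i < length (pack_pair u w)" "j < length (pack_pair u w)"
    "pack_pair u w ! i \<le> pack_pair u w ! j"
  then show "u ! i \<le> u ! j"
    using assms(2) by (auto simp: length_pack_pair pack_pair_nth_le_iff)
qed (use assms in \<open>simp_all add: packed_pack_pair length_pack_pair\<close>)

text \<open>The map \<open>F\<close> is strictly increasing on the letters of \<open>v\<close>:
  \<open>\<phi>\<close> increases weakly and \<open>\<psi>\<close> breaks the ties. As these letters
  form an initial interval, the rank of \<open>F b\<close> is \<open>b\<close>.\<close>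

lemma pack_pair_map_labeling:
  assumes v: "packed v" and \<phi>: "mono_on {1..} \<phi>"
    and \<psi>: "\<psi> \<in> strict_labelings (\<lambda>a b. a < b \<and> \<phi> a = \<phi> b) (set v)"
  shows "pack_pair (map \<phi> v) (map \<psi> v) = v"
proof -
  define F where "F b = (\<phi> b, \<psi> b)" for b
  have set_v: "set v = {1..max_letter v}" by (rule packed_set[OF v])
  have zip: "zip (map \<phi> v) (map \<psi> v) = map F v"
    by (simp add: zip_map_map zip_same_conv_map F_def)
  have lt: "\<not> lex_le (F b) (F a) \<and> lex_le (F a) (F b)" if "a \<in> set v" "b \<in> set v" "a < b" for a b
  proof -
    have "\<phi> a \<le> \<phi> b" using \<phi> that set_v by (auto elim!: mono_onD)
    moreover have "\<psi> a < \<psi> b" if "\<phi> a = \<phi> b"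
      using \<psi> that \<open>a \<in> set v\<close> \<open>b \<in> set v\<close> \<open>a < b\<close> by (auto simp: strict_labelings_def)
    ultimately show ?thesis by (auto simp: F_def)
  qed
  have iff: "lex_le (F a) (F b) \<longleftrightarrow> a \<le> b" if "a \<in> set v" "b \<in> set v" for a b
    using lt[of a b] lt[of b a] that lex_le_refl[of "F a"] by (metis linorder_neqE_nat nat_less_le nle_le)
  have inj: "inj_on F (set v)" using iff by (metis inj_onI lex_le_refl nle_le)
  have "card {q \<in> F ` set v. lex_le q (F b)} = b" if "b \<in> set v" for b
  proof -
    have sub: "{1..b} \<subseteq> set v" using that set_v by auto
    have "{q \<in> F ` set v. lex_le q (F b)} = F ` {a \<in> set v. a \<le> b}" using iff that by blast
    also have "{a \<in> set v. a \<le> b} = {1..b}" using that set_v by auto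
    finally show ?thesis using inj_on_subset[OF inj sub] by (simp add: card_image)
  qed
  then show ?thesis by (simp add: pack_pair_def zip map_idI)
qed

text \<open>Equal letters of \<open>v\<close> come from equal biletters, so \<open>w\<close> is a
  function of \<open>v\<close> letter by letter. Within a fibre of \<open>\<phi>\<close> the first
  components agree, so the second ones must increase strictly.\<close>

lemma labeling_of_pack_pair_eq:
  assumes w: "packed w" "length w = length v" and eq: "pack_pair (map \<phi> v) w = v"
  obtains \<psi> where "\<psi> \<in> strict_labelings (\<lambda>a b. a < b \<and> \<phi> a = \<phi> b) (set v)" "w = map \<psi> v"
proof
  have le_iff: "v ! i \<le> v ! j \<longleftrightarrow> lex_le (\<phi> (v ! i), w ! i) (\<phi> (v ! j), w ! j)"
    if "i < length v" "j < length v" for i j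
    using pack_pair_nth_le_iff[of "map \<phi> v" w i j] that w(2) by (simp add: eq del: lex_le.simps)
  \<comment> \<open>Any position of \<open>b\<close> in \<open>v\<close> will do, since
    \<open>le_iff\<close> in both directions shows that \<open>w\<close> has the same letter at all
    of them.\<close>
  define \<psi> where "\<psi> b = (if b \<in> set v then w ! (SOME i. i < length v \<and> v ! i = b) else 0)" for b
  have \<psi>: "\<psi> (v ! i) = w ! i" if "i < length v" for i
  proof -
    define j where "j = (SOME j. j < length v \<and> v ! j = v ! i)"
    have "j < length v \<and> v ! j = v ! i" unfolding j_def by (rule someI[of _ i]) (use that in simp)
    then have "w ! j = w ! i" using le_iff[of i j] le_iff[of j i] that by auto
    then show ?thesis using that by (simp add: \<psi>_def j_def)
  qed
  then show wv: "w = map \<psi> v" using w(2) by (intro nth_equalityI) auto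
  have "\<psi> a < \<psi> b" if "a \<in> set v" "b \<in> set v" "a < b" "\<phi> a = \<phi> b" for a b
  proof -
    obtain i j where ij: "i < length v" "a = v ! i" "j < length v" "b = v ! j"
      using \<open>a \<in> set v\<close> \<open>b \<in> set v\<close> by (metis in_set_conv_nth)
    then show ?thesis using le_iff[of j i] that by (auto simp: \<psi>)
  qed
  moreover have "\<exists>r. \<psi> ` set v = {1..r}" using w(1) by (simp add: wv packed_def)
  moreover have "\<psi> b = 0" if "b \<notin> set v" for b using that by (simp add: \<psi>_def)
  ultimately show "\<psi> \<in> strict_labelings (\<lambda>a b. a < b \<and> \<phi> a = \<phi> b) (set v)"
    by (auto simp: strict_labelings_def)
qed

text \<open>Turns the coefficient of \<open>N_basis v\<close> into a sum over strict labelings of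
  the letters of \<open>v\<close>.\<close>

lemma bij_betw_labelings_pack_pair:
  assumes "packed v" "mono_on {1..} \<phi>"
  shows "bij_betw (\<lambda>\<psi>. map \<psi> v) (strict_labelings (\<lambda>a b. a < b \<and> \<phi> a = \<phi> b) (set v))
    {w. packed w \<and> length w = length v \<and> pack_pair (map \<phi> v) w = v}"
    (is "bij_betw ?f ?L ?W")
proof (rule bij_betw_imageI)
  show "inj_on ?f ?L"
  proof (rule inj_onI)
    fix \<psi> \<psi>' assume L: "\<psi> \<in> ?L" "\<psi>' \<in> ?L" and "map \<psi> v = map \<psi>' v"
    then have "\<psi> x = \<psi>' x" if "x \<in> set v" for x using that by simp
    moreover have "\<psi> x = \<psi>' x" if "x \<notin> set v" for x using L that by (simp add: strict_labelings_def)
    ultimately show "\<psi> = \<psi>'" by blast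
  qed
  show "?f ` ?L = ?W"
  proof
    show "?f ` ?L \<subseteq> ?W"
      using pack_pair_map_labeling[OF assms] by (auto simp: strict_labelings_def packed_def)
    show "?W \<subseteq> ?f ` ?L"
      by (auto elim!: labeling_of_pack_pair_eq)
  qed
qed

section \<open>Blocks, their ends and the two statistics\<close>

lemma count_list_map_eq_sum:
  assumes "finite X" "set xs \<subseteq> X"
  shows "count_list (map f xs) y = (\<Sum>x | x \<in> X \<and> f x = y. count_list xs x)"
  using assms(2)
proof (induction xs)
  case (Cons a xs)
  have "(\<Sum>x | x \<in> X \<and> f x = y. count_list (a # xs) x) =
      (\<Sum>x | x \<in> X \<and> f x = y. count_list xs x + (if x = a then 1 else 0))"
    by (intro sum.cong) auto
  also have "\<dots> = count_list (map f xs) y + (if f a = y then 1 else 0)"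
    using Cons assms(1) by (simp add: sum.distrib)
  finally show ?case by simp
qed simp

lemma block_map: "block (map \<phi> v) v k = {b \<in> set v. \<phi> b = k}"
  by (auto simp: block_def zip_map1 zip_same_conv_map)

lemma last_sorted_eq_Max:
  assumes "sorted xs" "xs \<noteq> []"
  shows "last xs = Max (set xs)"
proof -
  have "x \<le> last xs" if "x \<in> set xs" for x
    using assms that by (induction xs) (auto split: if_splits)
  then show ?thesis using assms(2) by (intro Max_eqI[symmetric]) auto
qed

lemma last_block_mults:
  assumes "finite (block u v k)" "block u v k \<noteq> {}"
  shows "last (block_mults u v k) = count_list v (Max (block u v k))"
proof -
  have "sorted_list_of_set (block u v k) \<noteq> []" using assms by simp
  then have "last (block_mults u v k) = count_list v (last (sorted_list_of_set (block u v k)))"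
    by (simp add: block_mults_def last_map)
  also have "last (sorted_list_of_set (block u v k)) = Max (block u v k)"
    using assms last_sorted_eq_Max[of "sorted_list_of_set (block u v k)"] by simp
  finally show ?thesis .
qed

lemma sum_list_block_mults:
  assumes "finite (block u v k)"
  shows "sum_list (block_mults u v k) = (\<Sum>b\<in>block u v k. count_list v b)"
  using sum_list_distinct_conv_sum_set[of "sorted_list_of_set (block u v k)" "count_list v"] assms
  by (simp add: block_mults_def)

lemma sum_list_butlast_plus_last:
  "xs \<noteq> [] \<Longrightarrow> sum_list (butlast xs) + last xs = sum_list (xs :: 'a::monoid_add list)"
  by (induction xs) (auto simp: add.assoc)

context
  fixes u v :: "nat list" and \<phi> :: "nat \<Rightarrow> nat"
  assumes u: "packed u" and v: "packed v" and u_eq: "u = map \<phi> v"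
begin

lemma finite_block: "finite (block u v k)"
  by (simp add: u_eq block_map)

lemma block_nonempty:
  assumes "k \<in> {1..max_letter u}"
  shows "block u v k \<noteq> {}"
proof -
  have "k \<in> \<phi> ` set v" using assms unfolding packed_set[OF u, symmetric] by (simp add: u_eq)
  then show ?thesis by (auto simp: u_eq block_map)
qed

lemma g_stat_eq: "k \<in> {1..max_letter u} \<Longrightarrow> g_stat u v k = count_list v (Max (block u v k))"
  unfolding g_stat_def by (rule last_block_mults[OF finite_block block_nonempty])

text \<open>The blocks partition the letters of \<open>v\<close>, and in each block
  \<open>f_stat\<close> collects all multiplicities but the last, which is
  \<open>g_stat\<close>.\<close>

lemma f_stat_plus_sum_g_stat: "f_stat u v + (\<Sum>k=1..max_letter u. g_stat u v k) = length v"
proof -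
  have "f_stat u v + (\<Sum>k=1..max_letter u. g_stat u v k) =
      (\<Sum>k=1..max_letter u. \<Sum>b\<in>block u v k. count_list v b)"
    unfolding f_stat_def g_stat_def sum.distrib[symmetric]
  proof (rule sum.cong[OF refl])
    fix k assume k: "k \<in> {1..max_letter u}"
    have "block_mults u v k \<noteq> []"
      using block_nonempty[OF k] finite_block by (simp add: block_mults_def)
    then show "sum_list (butlast (block_mults u v k)) + last (block_mults u v k) =
        (\<Sum>b\<in>block u v k. count_list v b)"
      using sum_list_block_mults[OF finite_block] by (simp add: sum_list_butlast_plus_last)
  qed
  also have "\<dots> = (\<Sum>b\<in>set v. count_list v b)"
    using packed_set[OF u] unfolding u_eq block_map by (intro sum.group) auto
  also have "\<dots> = length v" by (simp add: sum_count_set)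
  finally show ?thesis .
qed

text \<open>The relation compares letters only within a fibre of \<open>\<phi>\<close>, so a letter
  is maximal exactly when it ends its block.\<close>

lemma maximal_elems_eq_block_ends:
  "maximal_elems (\<lambda>a b. a < b \<and> \<phi> a = \<phi> b) (set v) =
    (\<lambda>k. Max (block u v k)) ` {1..max_letter u}" (is "?M = ?E")
proof
  show "?M \<subseteq> ?E"
  proof
    fix b assume b: "b \<in> ?M"
    then have "\<phi> b \<in> {1..max_letter u}"
      using packed_set[OF u] by (auto simp: u_eq maximal_elems_def)
    moreover have "Max (block u v (\<phi> b)) = b"
      using b by (intro Max_eqI finite_block)
        (auto simp: u_eq block_map maximal_elems_def not_less)
    ultimately show "b \<in> ?E" by (metis image_eqI)
  qed
  show "?E \<subseteq> ?M"
  proof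
    fix b assume "b \<in> ?E"
    then obtain k where k: "k \<in> {1..max_letter u}" and b: "b = Max (block u v k)" by blast
    have "b \<in> block u v k" unfolding b by (rule Max_in[OF finite_block block_nonempty[OF k]])
    moreover have "c \<le> b" if "c \<in> block u v k" for c
      unfolding b using that by (rule Max_ge[OF finite_block])
    ultimately show "b \<in> ?M" by (fastforce simp: u_eq block_map maximal_elems_def)
  qed
qed

lemma inj_on_block_ends: "inj_on (\<lambda>k. Max (block u v k)) {1..max_letter u}"
proof (rule inj_on_inverseI[where g = \<phi>])
  fix k assume "k \<in> {1..max_letter u}"
  then have "Max (block u v k) \<in> block u v k" by (rule Max_in[OF finite_block block_nonempty])
  then show "\<phi> (Max (block u v k)) = k" by (simp add: u_eq block_map)
qed

text \<open>The exponent is \<open>f_stat u v\<close> plus the multiplicities of the block ends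
  outside \<open>T\<close>, so the sum is the expansion of a product with factors
  \<open>- 1 + t ^ g_stat u v k\<close>.\<close>

lemma sum_Pow_block_ends:
  fixes t :: "'a::comm_ring_1"
  defines "M \<equiv> maximal_elems (\<lambda>a b. a < b \<and> \<phi> a = \<phi> b) (set v)"
  shows "(\<Sum>T\<in>Pow M. (- 1) ^ card T * t ^ (length v - (\<Sum>b\<in>T. count_list v b))) =
    (- 1) ^ max_letter u * t ^ f_stat u v * (\<Prod>k=1..max_letter u. 1 - t ^ g_stat u v k)"
proof -
  have fin: "finite M" by (simp add: M_def maximal_elems_def)
  have M: "M = (\<lambda>k. Max (block u v k)) ` {1..max_letter u}"
    unfolding M_def by (rule maximal_elems_eq_block_ends)
  have len: "length v = f_stat u v + (\<Sum>b\<in>M. count_list v b)"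
    unfolding M f_stat_plus_sum_g_stat[symmetric] sum.reindex[OF inj_on_block_ends]
    by (simp add: g_stat_eq)
  have "(\<Sum>T\<in>Pow M. (- 1) ^ card T * t ^ (length v - (\<Sum>b\<in>T. count_list v b))) =
      (\<Sum>T\<in>Pow M. t ^ f_stat u v * ((\<Prod>b\<in>T. - 1) * (\<Prod>b\<in>M - T. t ^ count_list v b)))"
  proof (rule sum.cong[OF refl])
    fix T assume "T \<in> Pow M"
    then have "(\<Sum>b\<in>M. count_list v b) = (\<Sum>b\<in>M - T. count_list v b) + (\<Sum>b\<in>T. count_list v b)"
      using fin by (intro sum.subset_diff) auto
    \<comment> \<open>The subtraction is exact, because the sum over \<open>T\<close> is part of the
      sum over \<open>M\<close>.\<close>
    then have "length v - (\<Sum>b\<in>T. count_list v b) = f_stat u v + (\<Sum>b\<in>M - T. count_list v b)"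
      by (simp add: len)
    then show "(- 1) ^ card T * t ^ (length v - (\<Sum>b\<in>T. count_list v b)) =
        t ^ f_stat u v * ((\<Prod>b\<in>T. - 1) * (\<Prod>b\<in>M - T. t ^ count_list v b))"
      by (simp add: power_add power_sum mult_ac)
  qed
  also have "\<dots> = t ^ f_stat u v * (\<Prod>b\<in>M. - 1 + t ^ count_list v b)"
    unfolding prod_add[OF fin] by (rule sum_distrib_left[symmetric])
  also have "(\<Prod>b\<in>M. - 1 + t ^ count_list v b) =
      (\<Prod>k=1..max_letter u. (- 1) * (1 - t ^ g_stat u v k))"
    unfolding M prod.reindex[OF inj_on_block_ends]
    by (intro prod.cong) (simp_all add: g_stat_eq)
  also have "\<dots> = (- 1) ^ max_letter u * (\<Prod>k=1..max_letter u. 1 - t ^ g_stat u v k)"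
    by (subst prod.distrib) simp
  finally show ?thesis by (simp add: mult_ac)
qed

lemma max_letter_le: "max_letter u \<le> max_letter v"
proof -
  have "card (set u) \<le> card (set v)" unfolding u_eq set_map by (rule card_image_le) simp
  then show ?thesis unfolding packed_set[OF u] packed_set[OF v] by simp
qed

end

section \<open>The coefficient of a finer word, and the expansion\<close>

lemma last_ev: "max_letter w > 0 \<Longrightarrow> last (ev w) = count_list w (max_letter w)"
  by (simp add: ev_def)

lemma sum_lookup_Theta_pack_pair:
  fixes t :: "'a::field"
  assumes "finer v u"
  shows "(\<Sum>w | packed w \<and> length w = length u \<and> pack_pair u w = v.
      Poly_Mapping.lookup (Theta t (length u)) w) =
    (- 1) ^ (max_letter v - max_letter u) * t ^ f_stat u v *
      (\<Prod>k=1..max_letter u. 1 - t ^ g_stat u v k)"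
proof -
  obtain \<phi> where u: "packed u" and v: "packed v" and u_eq: "u = map \<phi> v" and \<phi>: "mono_on {1..} \<phi>"
    using assms by (auto simp: finer_def)
  let ?n = "length v"
  have n: "length u = ?n" by (simp add: u_eq)
  let ?R = "\<lambda>a b. a < b \<and> \<phi> a = \<phi> b"
  show ?thesis
  \<comment> \<open>The empty word is separate: its coefficient in \<open>Theta t 0\<close> is 1 and
    not a difference of powers.\<close>
  proof (cases "v = []")
    case True
    then have "{w. packed w \<and> length w = length u \<and> pack_pair u w = v} = {[]}"
      by (auto simp: u_eq pack_pair_def packed_def intro: exI[of _ 0])
    then show ?thesis
      using True v by (simp add: u_eq lookup_Theta max_letter_def f_stat_def)
  next
    case False
    \<comment> \<open>Chosen so that \<open>h {}\<close> is \<open>t ^ ?n\<close> and, on the top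
      fibre of a labeling, \<open>h\<close> is the other power in
      \<open>lookup_Theta\<close>.\<close>
    define h where "h T = t ^ (?n - (\<Sum>b\<in>T. count_list v b))" for T
    have "(\<Sum>w | packed w \<and> length w = length u \<and> pack_pair u w = v.
          Poly_Mapping.lookup (Theta t (length u)) w) =
        (\<Sum>\<psi>\<in>strict_labelings ?R (set v). Poly_Mapping.lookup (Theta t ?n) (map \<psi> v))"
      unfolding n using bij_betw_labelings_pack_pair[OF v \<phi>]
      by (intro sum.reindex_bij_betw[symmetric]) (simp add: u_eq)
    also have "\<dots> = (\<Sum>\<psi>\<in>strict_labelings ?R (set v).
        (- 1) ^ card (\<psi> ` set v) * (h {} - h {x \<in> set v. \<psi> x = card (\<psi> ` set v)}))"
    proof (rule sum.cong[OF refl])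
      fix \<psi> assume \<psi>: "\<psi> \<in> strict_labelings ?R (set v)"
      have im: "set (map \<psi> v) = {1..card (\<psi> ` set v)}"
        using strict_labelings_image[OF \<psi>] by simp
      then have packed: "packed (map \<psi> v)" unfolding packed_def by blast
      have r: "max_letter (map \<psi> v) = card (\<psi> ` set v)"
        using packed_set[OF packed] by simp
      have "card (\<psi> ` set v) > 0" using False by (simp add: card_gt_0_iff)
      \<comment> \<open>The multiplicity of the top letter of \<open>map \<psi> v\<close> is the
        total multiplicity in \<open>v\<close> of the top fibre.\<close>
      then have "last (ev (map \<psi> v)) = (\<Sum>b | b \<in> set v \<and> \<psi> b = card (\<psi> ` set v). count_list v b)"
        by (simp add: last_ev r count_list_map_eq_sum[of "set v"])
      then show "Poly_Mapping.lookup (Theta t ?n) (map \<psi> v) =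
          (- 1) ^ card (\<psi> ` set v) * (h {} - h {x \<in> set v. \<psi> x = card (\<psi> ` set v)})"
        using packed False by (simp add: lookup_Theta r h_def)
    qed
    also have "\<dots> = (- 1) ^ card (set v) * (\<Sum>T\<in>Pow (maximal_elems ?R (set v)). (- 1) ^ card T * h T)"
      by (rule sum_strict_labelings_top_fibre) (use False in auto)
    also have "card (set v) = max_letter v" using packed_set[OF v] by simp
    finally show ?thesis
      unfolding h_def sum_Pow_block_ends[OF u v u_eq]
      by (simp add: neg_one_power_diff[OF max_letter_le[OF u v u_eq]] mult.assoc)
  qed
qed

theorem theorem6p9:
  fixes t :: "'a::field" and u :: "nat list" and n :: nat
  assumes "packed u" and "length u = n"
  shows "internal_prod (N_basis u) (Theta t n) =
    (\<Sum>v | finer v u.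
       scale ((- 1) ^ (max_letter v - max_letter u) * t ^ f_stat u v *
              (\<Prod>k=1..max_letter u. 1 - t ^ g_stat u v k))
         (N_basis v))"
    (is "?L = (\<Sum>v | finer v u. scale (?c v) (N_basis v))")
proof (rule poly_mapping_eqI)
  fix v
  have "Poly_Mapping.lookup ?L v =
      (\<Sum>w | w \<in> {w. packed w \<and> length w = n} \<and> pack_pair u w = v. Poly_Mapping.lookup (Theta t n) w)"
    by (rule lookup_internal_prod_N_basis) (auto simp: finite_packed lookup_Theta assms(2))
  also have "\<dots> = (if finer v u then ?c v else 0)"
  proof (cases "finer v u")
    case True
    then show ?thesis
      using sum_lookup_Theta_pack_pair[OF True, of t] by (simp add: assms(2) conj_assoc)
  next
    case False
    \<comment> \<open>Packing \<open>u\<close> with any word of the same length gives a word finer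
      than \<open>u\<close>, so no other \<open>v\<close> occurs.\<close>
    then have "{w. w \<in> {w. packed w \<and> length w = n} \<and> pack_pair u w = v} = {}"
      using finer_pack_pair[OF assms(1)] assms(2) by auto
    then show ?thesis using False by (simp only: sum.empty if_False)
  qed
  also have "\<dots> = Poly_Mapping.lookup (\<Sum>v | finer v u. scale (?c v) (N_basis v)) v"
  proof -
    have "Poly_Mapping.lookup (\<Sum>v | finer v u. scale (?c v) (N_basis v)) v =
        (\<Sum>v' | finer v' u. if v' = v then ?c v' else 0)"
      unfolding lookup_sum
      by (intro sum.cong) (auto simp: lookup_scale N_basis_def lookup_single when_def)
    then show ?thesis using finite_finer[of u] by simp
  qed
  finally show "Poly_Mapping.lookup ?L v =
      Poly_Mapping.lookup (\<Sum>v | finer v u. scale (?c v) (N_basis v)) v" .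
qed

end
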